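(* There exists a constant $c$ such that for all sufficiently large $N$, $$\min_{E_N \in \{0,1\}^N} \mathcal{N}(E_N) \leq c (\log N)^2.$$
   Context: For a finite binary sequence $E_N = (e_1, \dots, e_N) \in \{0,1\}^N$, integers $k \geq 1$, $M \geq 1$ and $X \in \{0,1\}^k$, let $$T(E_N,M,X) = \# \{ n : 0 \leq n < M \text{ and } (e_{n+1},\dots,e_{n+k}) = X \}.$$ The normality measure of $E_N$ is $$\mathcal{N}(E_N) = \max_{1 \leq k \leq \log_2 N}\ \max_{X \in \{0,1\}^k}\ \max_{1 \leq M \leq N+1-k} \left| T(E_N,M,X) - \frac{M}{2^k}\right|,$$ where $k$ ranges over integers. *)

theory Defs
  imports Complex_Main
begin

definition binary_words :: "nat \<Rightarrow> nat list set" where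
  "binary_words k = {w. set w \<subseteq> {0, 1} \<and> length w = k}"

text \<open>
  Lists are indexed from 0, so the entry \<open>e\<^sub>i\<close> is \<open>E ! (i - 1)\<close> and the block
  \<open>(e\<^sub>n\<^sub>+\<^sub>1, \<dots>, e\<^sub>n\<^sub>+\<^sub>k)\<close> is \<open>take k (drop n E)\<close>. The length \<open>k\<close> is that of \<open>X\<close>.
\<close>

definition block_count :: "nat list \<Rightarrow> nat \<Rightarrow> nat list \<Rightarrow> nat" where
  "block_count E M X = card {n. n < M \<and> take (length X) (drop n E) = X}"

text \<open>
  The index sets of the maxima are finite, and they are nonempty once \<open>length E \<ge> 2\<close>;
  for shorter sequences there is no admissible \<open>k\<close> and the value is unspecified.
\<close>

definition normality_measure :: "nat list \<Rightarrow> real" where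
  "normality_measure E =
    (MAX k \<in> {k::nat. 1 \<le> k \<and> real k \<le> log 2 (real (length E))}.
      MAX X \<in> binary_words k.
        MAX M \<in> {1..length E + 1 - k}.
          \<bar>real (block_count E M X) - real M / 2 ^ k\<bar>)"

end

theory Submission
  imports Defs "HOL-Library.Z2" "HOL-Computational_Algebra.Polynomial"
begin

text \<open>
  We use Levin's sequence in a finite form. Let \<open>n\<close> be the least power of two with \<open>N \<le>
  2\<^sup>n\<close>, so that \<open>n \<le> 2 log\<^sub>2 N\<close>, and let the row of \<open>w <
  2\<^sup>n\<close> be the coefficient vector over \<open>F\<^sub>2\<close> of the polynomial \<open>W(1 +
  x)\<close>, where \<open>W\<close> has the \<open>n\<close> binary digits of \<open>w\<close> as
  coefficients, the most significant one being the constant term. The sequence is the concatenation of the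
  rows of \<open>0, 1, 2, \<dots>\<close>. For \<open>j \<le> n\<close> consider the rows of an aligned block
  of \<open>2\<^sup>j\<close> consecutive numbers, closed up to a cycle. Because \<open>(1 + x)\<^sup>n = 1 +
  x\<^sup>n\<close>, windows of length \<open>j\<close> that start at a fixed place \<open>r\<close> of a row
  determine the row, so each word of length \<open>j\<close> occurs there exactly once. Hence a word of length
  \<open>k \<le> j\<close> occurs \<open>n 2\<^sup>j / 2\<^sup>k\<close> times in the block up to an error
  \<open>n\<close>, and cutting a prefix into at most \<open>n - k\<close> such blocks and a remainder inside
  a block of \<open>2\<^sup>k\<close> rows gives a total error \<open>O(n\<^sup>2)\<close>.
\<close>

section \<open>Polynomials in powers of \<open>1 + x\<close>\<close>

text \<open>The factor \<open>monom 1 s\<close> does not vanish at -1, so it leaves the order of the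
  root -1 unchanged.\<close>

lemma one_plus_X_dvd_cancel:
  fixes q :: "'a::field poly"
  assumes "[:1, 1:] ^ m dvd monom 1 s * q"
  shows "[:1, 1:] ^ m dvd q"
proof (cases "q = 0")
  case False
  have nz: "monom 1 s * q \<noteq> 0"
    using False by simp
  have "order (-1) (monom (1::'a) s) = 0"
    by (rule order_0I) (simp add: poly_monom)
  then have "order (-1) (monom 1 s * q) = order (-1) q"
    using order_mult[OF nz] by simp
  moreover have "[:- (-1), 1:] ^ m dvd monom 1 s * q"
    using assms by simp
  ultimately have "m \<le> order (-1) q"
    using nz order_divides by metis
  then show ?thesis
    using order_divides[of "-1" m q] by simp
qed simp

text \<open>Splitting off x^l leaves a cofactor still divisible by (1 + x)^m; were it nonzero,
  \<open>p\<close> would have degree at least m + l.\<close>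

lemma one_plus_X_low_coeffs_zero:
  fixes p :: "'a::field poly"
  assumes "[:1, 1:] ^ m dvd p" "\<And>i. i < l \<Longrightarrow> coeff p i = 0" "degree p < m + l"
  shows "p = 0"
proof (rule ccontr)
  assume "p \<noteq> 0"
  have "monom 1 l dvd p"
    using assms(2) by (simp add: monom_1_dvd_iff')
  then obtain q where q: "p = monom 1 l * q" ..
  then have "q \<noteq> 0"
    using \<open>p \<noteq> 0\<close> by auto
  have "m \<le> degree q"
    using dvd_imp_degree_le[OF one_plus_X_dvd_cancel \<open>q \<noteq> 0\<close>, of m l] assms(1) q
    by (simp add: degree_power_eq)
  moreover have "degree p = l + degree q"
    using q \<open>q \<noteq> 0\<close> by (simp add: degree_mult_eq degree_monom_eq)
  ultimately show False
    using assms(3) by simp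
qed

text \<open>In characteristic 2 the cross term of each squaring vanishes. This is why the row length
  is taken to be a power of two.\<close>

lemma one_plus_X_power_two_power:
  assumes "(2::'a::comm_ring_1) = 0"
  shows "[:1, 1:] ^ (2 ^ d) = 1 + monom (1::'a) (2 ^ d)"
proof (induction d)
  case 0
  show ?case by (simp add: monom_altdef one_pCons)
next
  case (Suc d)
  have "(2::'a poly) = [:2:]"
    by (simp add: numeral_poly)
  then have two: "(2::'a poly) = 0"
    using assms by simp
  have "[:1, 1:] ^ (2 ^ Suc d) = ([:1, 1:] ^ (2 ^ d) :: 'a poly)\<^sup>2"
    by (simp add: power_mult[symmetric] mult.commute)
  also have "\<dots> = 1 + 2 * monom 1 (2 ^ d) + (monom 1 (2 ^ d))\<^sup>2"
    unfolding Suc by (simp add: power2_eq_square algebra_simps)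
  also have "\<dots> = 1 + monom 1 (2 ^ Suc d)"
    unfolding two by (simp add: monom_power mult.commute)
  finally show ?case .
qed

text \<open>Since \<open>(1 + x)\<^sup>n = x\<^sup>n - 1\<close> here, rotating the coefficients cyclically preserves
  divisibility by \<open>(1 + x)\<^sup>n\<^sup>-\<^sup>k\<close>; a rotation moves the gap of \<open>k\<close> zeros to the top.\<close>

lemma one_plus_X_gap_zero:
  fixes p :: "'a::field poly"
  assumes two: "(2::'a) = 0" and n: "n = 2 ^ d" and rk: "r + k \<le> n"
    and dvd: "[:1, 1:] ^ (n - k) dvd p"
    and gap: "\<And>i. r \<le> i \<Longrightarrow> i < r + k \<Longrightarrow> coeff p i = 0"
    and top: "\<And>i. n \<le> i \<Longrightarrow> coeff p i = 0"
  shows "p = 0"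
proof -
  define L where "L = poly_cutoff r p"
  define U where "U = poly_shift (r + k) p"
  \<comment> \<open>The rotation of \<open>p\<close>: \<open>U\<close> comes first, then
    \<open>L\<close>, so all coefficients from n - k on vanish.\<close>
  define q where "q = U + monom 1 (n - r - k) * L"
  have split: "p = L + monom 1 (r + k) * U"
    by (rule poly_eqI) (auto simp: L_def U_def coeff_poly_cutoff coeff_poly_shift coeff_monom_mult gap)
  have "n > 0" using n by simp
  have minus: "- x = x" for x :: "'a poly"
  proof -
    have "(2::'a poly) = [:2:]" by (simp add: numeral_poly)
    then have "x + x = 0" using two by (metis mult_2 mult_zero_left pCons_0_0)
    then show ?thesis by (simp add: minus_unique)
  qed
  have rot: "monom 1 (r + k) * q = p + [:1, 1:] ^ n * L"
  proof -
    have "monom 1 (r + k) * q = monom 1 (r + k) * U + monom 1 n * L"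
      using rk by (simp add: q_def distrib_left mult.assoc[symmetric] mult_monom)
    also have "\<dots> = p - L + monom 1 n * L"
      using split by (metis add_diff_cancel_left')
    also have "\<dots> = p + (1 + monom 1 n) * L"
      using minus[of L] by (simp add: algebra_simps)
    finally show ?thesis
      by (simp add: n one_plus_X_power_two_power[OF two])
  qed
  have "[:1, 1:] ^ (n - k) dvd [:1, 1:] ^ n * L"
    by (simp add: le_imp_power_dvd)
  then have "[:1, 1:] ^ (n - k) dvd q"
    using dvd rot by (metis dvd_add one_plus_X_dvd_cancel)
  moreover have "coeff q i = 0" if "n - k \<le> i" for i
    using that rk
    by (auto simp: q_def U_def L_def coeff_poly_shift coeff_poly_cutoff coeff_monom_mult intro: top)
  ultimately have "q = 0"
    using dvd_imp_degree_le[of "[:1, 1:] ^ (n - k)" q]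
    by (metis degree_linear_power leading_coeff_neq_0)
  \<comment> \<open>With \<open>q = 0\<close>, the identity \<open>rot\<close> makes
    \<open>p\<close> a multiple of (1 + x)^n, although its degree is below n.\<close>
  then have "[:1, 1:] ^ n dvd p"
    using rot by (metis add_eq_0_iff dvd_minus_iff dvd_triv_left mult_zero_right)
  then show ?thesis
    using dvd_imp_degree_le[of "[:1, 1:] ^ n" p] top
    by (metis degree_linear_power leading_coeff_neq_0)
qed

text \<open>Coefficient \<open>c 0\<close> belongs to the highest power of \<open>1 + x\<close>, so that numbers \<open>w\<close> in a common
  dyadic block differ, through their low bits, only in multiples of a high power of \<open>1 + x\<close>.\<close>

definition row_poly :: "nat \<Rightarrow> (nat \<Rightarrow> 'a::field) \<Rightarrow> 'a poly" where
  "row_poly n c = (\<Sum>b<n. smult (c b) ([:1, 1:] ^ (n - 1 - b)))"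

lemma coeff_row_poly_ge: "n \<le> i \<Longrightarrow> coeff (row_poly n c) i = 0"
  unfolding row_poly_def coeff_sum
  by (intro sum.neutral ballI) (auto simp: degree_power_eq intro!: coeff_eq_0)

lemma row_poly_diff: "row_poly n c - row_poly n c' = row_poly n (\<lambda>b. c b - c' b)"
  by (simp add: row_poly_def sum_subtractf smult_diff_left)

lemma row_poly_dvd:
  assumes "\<And>b. k \<le> b \<Longrightarrow> b < n \<Longrightarrow> c b = 0"
  shows "[:1, 1:] ^ (n - k) dvd row_poly n c"
  unfolding row_poly_def
proof (rule dvd_sum)
  fix b assume "b \<in> {..<n}"
  then show "[:1, 1:] ^ (n - k) dvd smult (c b) ([:1, 1:] ^ (n - 1 - b))"
    by (cases "b < k") (auto simp: assms intro!: dvd_smult le_imp_power_dvd)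
qed

text \<open>Triangularity: the terms after \<open>s\<close> have too small a degree to reach this
  coefficient, and (1 + x)^(n - 1 - s) is monic.\<close>

lemma coeff_row_poly_top:
  assumes "s < n" "\<And>b. b < s \<Longrightarrow> c b = 0"
  shows "coeff (row_poly n c) (n - 1 - s) = c s"
proof -
  have "coeff (row_poly n c) (n - 1 - s) = (\<Sum>b<n. c b * coeff ([:1, 1:] ^ (n - 1 - b)) (n - 1 - s))"
    by (simp add: row_poly_def coeff_sum)
  also have "\<dots> = (\<Sum>b\<in>{s}. c b * coeff ([:1, 1:] ^ (n - 1 - b)) (n - 1 - s))"
  proof (rule sum.mono_neutral_right)
    show "\<forall>b\<in>{..<n} - {s}. c b * coeff ([:1, 1:] ^ (n - 1 - b)) (n - 1 - s) = 0"
    proof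
      fix b assume "b \<in> {..<n} - {s}"
      then consider "b < s" | "n - 1 - b < n - 1 - s" by fastforce
      then show "c b * coeff ([:1, 1:] ^ (n - 1 - b)) (n - 1 - s) = 0"
        by cases (simp_all add: assms(2) coeff_eq_0 degree_linear_power)
    qed
  qed (use assms in auto)
  also have "\<dots> = c s"
    by (simp add: coeff_linear_power)
  finally show ?thesis .
qed

text \<open>The entries c 0, c 1, ... are read off successively, from the top coefficient
  downwards.\<close>

lemma row_poly_high_coeffs_zero:
  assumes "\<And>i. n - s \<le> i \<Longrightarrow> i < n \<Longrightarrow> coeff (row_poly n c) i = 0" "s \<le> n" "b < s"
  shows "c b = 0"
  using \<open>b < s\<close>
proof (induction b rule: less_induct)
  case (less b)
  then have "coeff (row_poly n c) (n - 1 - b) = c b"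
    using assms(2) by (intro coeff_row_poly_top) auto
  then show ?case
    using assms(1)[of "n - 1 - b"] assms(2) less.prems by simp
qed

lemma degree_row_poly:
  assumes "s < n" "\<And>b. b < s \<Longrightarrow> c b = 0"
  shows "degree (row_poly n c) < n - s"
proof -
  have "degree (row_poly n c) \<le> n - 1 - s"
    unfolding row_poly_def
  proof (rule degree_sum_le)
    fix b assume "b \<in> {..<n}"
    then show "degree (smult (c b) ([:1, 1:] ^ (n - 1 - b))) \<le> n - 1 - s"
      using assms by (cases "b < s") (auto simp: degree_linear_power)
  qed simp
  then show ?thesis using assms(1) by simp
qed

section \<open>Cyclic windows of Levin's sequence\<close>

definition levin_poly :: "nat \<Rightarrow> nat \<Rightarrow> bit poly" where
  "levin_poly n w = row_poly n (\<lambda>b. of_bool (bit w b))"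

definition levin_seq :: "nat \<Rightarrow> nat \<Rightarrow> bit" where
  "levin_seq n p = coeff (levin_poly n (p div n)) (p mod n)"

text \<open>Successor within the aligned block of \<open>2 ^ k\<close> consecutive numbers, wrapping around at its end.\<close>

definition cyclic_succ :: "nat \<Rightarrow> nat \<Rightarrow> nat" where
  "cyclic_succ k w = w div 2 ^ k * 2 ^ k + (w + 1) mod 2 ^ k"

text \<open>Here \<open>k\<close> is both window length and block exponent, so a block has as many
  rows as there are words of that length. Two rows suffice when k \<le> n.\<close>

definition cyclic_window :: "nat \<Rightarrow> nat \<Rightarrow> nat \<Rightarrow> nat \<Rightarrow> bit list" where
  "cyclic_window n k r w = map (\<lambda>t. if r + t < n then coeff (levin_poly n w) (r + t)
     else coeff (levin_poly n (cyclic_succ k w)) (r + t - n)) [0..<k]"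

lemma length_cyclic_window [simp]: "length (cyclic_window n k r w) = k"
  by (simp add: cyclic_window_def)

lemma bit_eq_above:
  assumes "w div 2 ^ k = w' div (2 ^ k :: nat)" "k \<le> b"
  shows "bit w b = bit w' b"
proof -
  have "bit (drop_bit k w) (b - k) = bit (drop_bit k w') (b - k)"
    using assms by (simp add: drop_bit_eq_div)
  then show ?thesis
    using assms(2) by (simp add: bit_drop_bit_eq)
qed

lemma bit_eq_below_iff:
  "w mod 2 ^ s = w' mod (2 ^ s :: nat) \<longleftrightarrow> (\<forall>b<s. bit w b = bit w' b)"
  by (auto simp: take_bit_eq_mod[symmetric] bit_eq_iff bit_take_bit_iff)

lemma cyclic_succ_div: "cyclic_succ k w div 2 ^ k = w div 2 ^ k"
  by (simp add: cyclic_succ_def)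

lemma cyclic_succ_mod:
  assumes "s \<le> k"
  shows "cyclic_succ k w mod 2 ^ s = (w + 1) mod 2 ^ s"
proof -
  have "(2::nat) ^ s dvd 2 ^ k" using assms by (rule le_imp_power_dvd)
  then show ?thesis
    by (simp add: cyclic_succ_def mod_add_eq[symmetric] mod_mod_cancel)
qed

lemma Suc_mod_eq_iff: "Suc a mod m = Suc b mod m \<longleftrightarrow> a mod m = b mod m"
  by (auto simp: mod_Suc split: if_splits)

lemma cyclic_succ_inject:
  assumes "w div 2 ^ k = w' div 2 ^ k" "cyclic_succ k w = cyclic_succ k w'"
  shows "w = w'"
proof -
  have "(w + 1) mod 2 ^ k = (w' + 1) mod 2 ^ k"
    using assms(2) cyclic_succ_mod[of k k w] cyclic_succ_mod[of k k w'] by simp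
  then have "w mod 2 ^ k = w' mod 2 ^ k"
    using Suc_mod_eq_iff[of w _ w'] by simp
  then show ?thesis
    using assms(1) by (metis div_mult_mod_eq)
qed

lemma bit_two_eq_zero: "(2::bit) = 0"
  by simp

lemma of_bool_diff_eq_0_iff: "of_bool P - of_bool Q = (0::bit) \<longleftrightarrow> P = Q"
  by (cases P; cases Q) simp_all

text \<open>A window inside one row is settled by the gap lemma. A window that wraps around first determines
  the low \<open>s = n - r\<close> bits of \<open>w\<close>, hence those of its successor; the start of the successor's row then
  determines the remaining \<open>k - s\<close> varying bits.\<close>

lemma cyclic_window_inject:
  assumes n: "n = 2 ^ d" and "k \<le> n" "r < n"
    and div_eq: "w div 2 ^ k = w' div 2 ^ k"
    and win: "cyclic_window n k r w = cyclic_window n k r w'"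
  shows "w = w'"
proof -
  \<comment> \<open>By linearity of \<open>row_poly\<close>, rows are compared through the
    differences of their digits over the two-element field.\<close>
  define c where "c = (\<lambda>(v::nat) (v'::nat) b. of_bool (bit v b) - of_bool (bit v' b) :: bit)"
  have diff: "levin_poly n v - levin_poly n v' = row_poly n (c v v')" for v v'
    by (simp only: levin_poly_def row_poly_diff c_def)
  have c0: "c v v' b = 0 \<longleftrightarrow> bit v b = bit v' b" for v v' b
    unfolding c_def by (rule of_bool_diff_eq_0_iff)
  have dvd: "[:1, 1:] ^ (n - k) dvd row_poly n (c v v')" if "v div 2 ^ k = v' div 2 ^ k" for v v'
    by (rule row_poly_dvd) (metis c0 bit_eq_above that)
  \<comment> \<open>All \<open>n\<close> digits agree; those below \<open>k\<close> together with
    the common quotient fix the number.\<close>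
  have row0: "v = v'" if "row_poly n (c v v') = 0" "v div 2 ^ k = v' div 2 ^ k" for v v'
  proof -
    have "c v v' b = 0" if "b < n" for b
      by (rule row_poly_high_coeffs_zero[where s = n and n = n])
        (simp_all add: \<open>row_poly n (c v v') = 0\<close> that)
    then have "v mod 2 ^ k = v' mod 2 ^ k"
      unfolding bit_eq_below_iff using \<open>k \<le> n\<close> c0 by simp
    then show ?thesis using that(2) by (metis div_mult_mod_eq)
  qed
  have win1: "coeff (row_poly n (c w w')) (r + t) = 0" if "t < k" "r + t < n" for t
  proof -
    have "cyclic_window n k r w ! t = cyclic_window n k r w' ! t" using win by simp
    then show ?thesis using that unfolding cyclic_window_def by (simp flip: diff del: minus_bit_def)
  qed
  have win2: "coeff (row_poly n (c (cyclic_succ k w) (cyclic_succ k w'))) (r + t - n) = 0"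
    if "t < k" "n \<le> r + t" for t
  proof -
    have "cyclic_window n k r w ! t = cyclic_window n k r w' ! t" using win by simp
    then show ?thesis using that unfolding cyclic_window_def by (simp flip: diff del: minus_bit_def)
  qed
  show ?thesis
  proof (cases "r + k \<le> n")
    case True
    have "row_poly n (c w w') = 0"
    proof (rule one_plus_X_gap_zero[OF bit_two_eq_zero n True dvd[OF div_eq]])
      fix i assume "r \<le> i" "i < r + k"
      then show "coeff (row_poly n (c w w')) i = 0"
        using win1[of "i - r"] True by simp
    qed (rule coeff_row_poly_ge)
    then show ?thesis using row0 div_eq by blast
  next
    case False
    define s where "s = n - r"
    have s: "s \<le> n" "s \<le> k" "n - s = r" using False \<open>r < n\<close> by (auto simp: s_def)
    have "c w w' b = 0" if "b < s" for b
    proof (rule row_poly_high_coeffs_zero[OF _ s(1) that])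
      fix i assume "n - s \<le> i" "i < n"
      then show "coeff (row_poly n (c w w')) i = 0"
        using win1[of "i - r"] s False by simp
    qed
    then have "w mod 2 ^ s = w' mod 2 ^ s"
      by (simp add: bit_eq_below_iff c0)
    then have "cyclic_succ k w mod 2 ^ s = cyclic_succ k w' mod 2 ^ s"
      using s(2) by (simp add: cyclic_succ_mod Suc_mod_eq_iff)
    then have low: "c (cyclic_succ k w) (cyclic_succ k w') b = 0" if "b < s" for b
      using that by (simp add: bit_eq_below_iff c0)
    have sdiv: "cyclic_succ k w div 2 ^ k = cyclic_succ k w' div 2 ^ k"
      using div_eq by (simp add: cyclic_succ_div)
    have "row_poly n (c (cyclic_succ k w) (cyclic_succ k w')) = 0"
    proof (rule one_plus_X_low_coeffs_zero[OF dvd[OF sdiv]])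
      \<comment> \<open>Agreement of the low \<open>s\<close> digits of the successors brings the
        degree below n - s, which is what k - s known zero coefficients can handle.\<close>
      show "degree (row_poly n (c (cyclic_succ k w) (cyclic_succ k w'))) < n - k + (k - s)"
        using degree_row_poly[of s n "c (cyclic_succ k w) (cyclic_succ k w')", OF _ low] s False \<open>k \<le> n\<close> by simp
      fix i assume "i < k - s"
      moreover from this have eqs: "r + (i + s) - n = i" "i + s < k" "n \<le> r + (i + s)"
        using s by linarith+
      ultimately show "coeff (row_poly n (c (cyclic_succ k w) (cyclic_succ k w'))) i = 0"
        using win2[of "i + s"] eqs by simp
    qed
    then show ?thesis using row0 sdiv cyclic_succ_inject div_eq by blast
  qed
qed

section \<open>Windows over an aligned block of rows\<close>

lemma finite_bit_lists: "finite {xs :: bit list. length xs = k}"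
  and card_bit_lists: "card {xs :: bit list. length xs = k} = 2 ^ k"
proof -
  have UNIV: "(UNIV :: bit set) = {0, 1}" by auto
  have fin: "finite (UNIV :: bit set)" and card: "card (UNIV :: bit set) = 2"
    unfolding UNIV by simp_all
  show "finite {xs :: bit list. length xs = k}" "card {xs :: bit list. length xs = k} = 2 ^ k"
    using card_lists_length_eq[OF fin, of k] finite_lists_length_eq[OF fin, of k] card by simp_all
qed

text \<open>Both sides have \<open>2 ^ j\<close> elements, so injectivity suffices.\<close>

lemma cyclic_window_bij:
  assumes "n = 2 ^ d" "j \<le> n" "r < n"
  shows "bij_betw (cyclic_window n j r) {q * 2 ^ j..<(q + 1) * 2 ^ j} {xs. length xs = j}"
proof -
  have block: "w div 2 ^ j = q" if "w \<in> {q * 2 ^ j..<(q + 1) * 2 ^ j}" for w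
    using that by (auto intro!: div_nat_eqI simp: algebra_simps)
  have inj: "inj_on (cyclic_window n j r) {q * 2 ^ j..<(q + 1) * 2 ^ j}"
    by (rule inj_onI) (metis block cyclic_window_inject[OF assms])
  moreover have "cyclic_window n j r ` {q * 2 ^ j..<(q + 1) * 2 ^ j} = {xs. length xs = j}"
    by (rule card_subset_eq[OF finite_bit_lists])
      (use card_image[OF inj] in \<open>auto simp: card_bit_lists\<close>)
  ultimately show ?thesis by (simp add: bij_betw_def)
qed

text \<open>The rows counted correspond to the extensions of \<open>X\<close> to length
  \<open>j\<close>, whose remaining letters are free.\<close>

lemma card_cyclic_window_prefix:
  assumes "n = 2 ^ d" "j \<le> n" "r < n" "length X \<le> j"
  shows "card {w \<in> {q * 2 ^ j..<(q + 1) * 2 ^ j}. take (length X) (cyclic_window n j r w) = X}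
    = 2 ^ (j - length X)"
proof -
  have "bij_betw (cyclic_window n j r)
      {w \<in> {q * 2 ^ j..<(q + 1) * 2 ^ j}. take (length X) (cyclic_window n j r w) = X}
      {xs \<in> {xs. length xs = j}. take (length X) xs = X}" (is "bij_betw _ ?A ?B")
    by (rule bij_betw_Collect[OF cyclic_window_bij[OF assms(1-3)]]) simp
  then have "card ?A = card ?B"
    by (rule bij_betw_same_card)
  also have "?B = (@) X ` {ys. length ys = j - length X}"
  proof (intro equalityI subsetI)
    fix xs assume "xs \<in> ?B"
    then have "xs = X @ drop (length X) xs" "length (drop (length X) xs) = j - length X"
      by (metis (mono_tags) append_take_drop_id mem_Collect_eq, simp)
    then show "xs \<in> (@) X ` {ys. length ys = j - length X}"
      by blast
  qed (use assms(4) in auto)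
  also have "card \<dots> = 2 ^ (j - length X)"
    by (simp add: card_image inj_on_def card_bit_lists)
  finally show ?thesis .
qed

section \<open>Counting occurrences\<close>

text \<open>Only the starting position is confined to the interval; the occurrence may run past
  \<open>b\<close>. This makes the count additive over adjacent intervals.\<close>

definition occurrences :: "(nat \<Rightarrow> 'a) \<Rightarrow> 'a list \<Rightarrow> nat \<Rightarrow> nat \<Rightarrow> nat" where
  "occurrences f X a b = card {p \<in> {a..<b}. map f [p..<p + length X] = X}"

lemma occurrences_split:
  assumes "a \<le> b" "b \<le> c"
  shows "occurrences f X a c = occurrences f X a b + occurrences f X b c"
proof -
  define A where "A x y = {p \<in> {x..<y}. map f [p..<p + length X] = X}" for x y
  have "A a c = A a b \<union> A b c" "A a b \<inter> A b c = {}"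
    using assms by (auto simp: A_def)
  moreover have "finite (A x y)" for x y
    by (simp add: A_def)
  ultimately show ?thesis
    unfolding occurrences_def A_def[symmetric] by (simp add: card_Un_disjoint)
qed

text \<open>The last hypothesis says that \<open>w\<close> is not the last row of its block, so its
  cyclic successor is the true one.\<close>

lemma levin_seq_window:
  assumes "k \<le> j" "j \<le> n" "r < n" "Suc w mod 2 ^ j \<noteq> 0"
  shows "map (levin_seq n) [n * w + r..<n * w + r + k] = take k (cyclic_window n j r w)"
proof (rule nth_equalityI)
  fix t assume "t < length (map (levin_seq n) [n * w + r..<n * w + r + k])"
  then have t: "t < k" by simp
  have "Suc w mod 2 ^ j = Suc (w mod 2 ^ j)"
    using assms(4) by (simp add: mod_Suc split: if_splits)
  then have succ: "cyclic_succ j w = Suc w"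
    by (simp add: cyclic_succ_def div_mult_mod_eq)
  have "levin_seq n (n * w + (r + t)) = cyclic_window n j r w ! t"
  proof (cases "r + t < n")
    case True
    then show ?thesis
      using t assms by (simp add: levin_seq_def cyclic_window_def)
  next
    case False
    then have "n * w + (r + t) = n * Suc w + (r + t - n)" "r + t - n < n"
      using t assms by auto
    then have "levin_seq n (n * w + (r + t)) = coeff (levin_poly n (Suc w)) (r + t - n)"
      unfolding levin_seq_def by (simp del: mult_Suc_right)
    then show ?thesis
      using t assms False by (simp add: succ cyclic_window_def)
  qed
  then show "map (levin_seq n) [n * w + r..<n * w + r + k] ! t = take k (cyclic_window n j r w) ! t"
    using t by (simp add: add.assoc)
qed (use assms in simp)

text \<open>A position splits into a column and a row, and each of the \<open>n\<close> columns
  contributes the same count.\<close>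

lemma card_cyclic_occurrences:
  assumes "n = 2 ^ d" "j \<le> n" "length X \<le> j"
  shows "card {p \<in> {n * (q * 2 ^ j)..<n * ((q + 1) * 2 ^ j)}.
    take (length X) (cyclic_window n j (p mod n) (p div n)) = X} = n * 2 ^ (j - length X)"
    (is "card ?Z = _")
proof -
  have "n > 0" using assms(1) by simp
  define W where "W r = {w \<in> {q * 2 ^ j..<(q + 1) * 2 ^ j}.
    take (length X) (cyclic_window n j r w) = X}" for r
  have "bij_betw (\<lambda>p. (p mod n, p div n)) ?Z (Sigma {..<n} W)"
  proof (rule bij_betw_byWitness[where f' = "\<lambda>(r, w). n * w + r"])
    show "(\<lambda>p. (p mod n, p div n)) ` ?Z \<subseteq> Sigma {..<n} W"
      using \<open>n > 0\<close>
      by (auto simp: W_def less_mult_imp_div_less mult.commute[of n] less_eq_div_iff_mult_less_eq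
          simp del: mult_Suc mult_Suc_right)
    show "(\<lambda>(r, w). n * w + r) ` Sigma {..<n} W \<subseteq> ?Z"
    proof (rule image_subsetI, unfold split_paired_all prod.case)
      fix r w assume "(r, w) \<in> Sigma {..<n} W"
      then have "r < n" and w: "w \<in> W r" by auto
      from w have "n * (q * 2 ^ j) \<le> n * w" "n * Suc w \<le> n * ((q + 1) * 2 ^ j)"
        unfolding W_def by (auto intro!: mult_le_mono2 simp del: mult_Suc_right)
      then have "n * w + r \<in> {n * (q * 2 ^ j)..<n * ((q + 1) * 2 ^ j)}"
        using \<open>r < n\<close> by (auto intro: trans_le_add1)
      then show "n * w + r \<in> ?Z"
        using w \<open>r < n\<close> by (simp add: W_def)
    qed
  qed auto
  then have "card ?Z = card (Sigma {..<n} W)"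
    by (rule bij_betw_same_card)
  also have "\<dots> = (\<Sum>r<n. card (W r))"
    by (rule card_SigmaI) (auto simp: W_def)
  also have "\<dots> = (\<Sum>r<n. 2 ^ (j - length X))"
    unfolding W_def by (intro sum.cong refl card_cyclic_window_prefix[OF assms(1,2) _ assms(3)]) auto
  finally show ?thesis by simp
qed

section \<open>Discrepancy over blocks and prefixes\<close>

lemma card_diff_le_card:
  assumes "finite A" "finite B" "finite L" "A - L = B - L"
  shows "\<bar>real (card A) - real (card B)\<bar> \<le> real (card L)"
proof -
  have "card A \<le> card (A - L) + card L" "card B \<le> card (B - L) + card L"
    using diff_card_le_card_Diff[OF assms(3)] by (metis le_diff_conv)+
  moreover have "card (A - L) \<le> card A" "card (B - L) \<le> card B"
    using assms by (auto intro: card_mono)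
  ultimately show ?thesis using assms(4) by (simp add: abs_le_iff)
qed

text \<open>The cyclic count is exact; true and cyclic windows can differ only at the
  \<open>n\<close> starting positions in the last row of the block.\<close>

lemma occurrences_levin_block:
  assumes "n = 2 ^ d" "j \<le> n" "length X \<le> j"
  shows "\<bar>real (occurrences (levin_seq n) X (n * (q * 2 ^ j)) (n * ((q + 1) * 2 ^ j)))
    - real (n * 2 ^ j) / 2 ^ length X\<bar> \<le> real n"
proof -
  define I where "I = {n * (q * 2 ^ j)..<n * ((q + 1) * 2 ^ j)}"
  define L where "L = {n * ((q + 1) * 2 ^ j - 1)..<n * ((q + 1) * 2 ^ j)}"
  define A where "A = {p \<in> I. map (levin_seq n) [p..<p + length X] = X}"
  define Z where "Z = {p \<in> I. take (length X) (cyclic_window n j (p mod n) (p div n)) = X}"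
  have "n > 0" using assms(1) by simp
  have "map (levin_seq n) [p..<p + length X] = take (length X) (cyclic_window n j (p mod n) (p div n))"
    if p: "p \<in> I - L" for p
  proof -
    have "p div n < (q + 1) * 2 ^ j - 1" "q * 2 ^ j \<le> p div n"
      using p \<open>n > 0\<close>
      by (auto simp: I_def L_def less_mult_imp_div_less mult.commute[of n] less_eq_div_iff_mult_less_eq
          not_le)
    then have "q * 2 ^ j < Suc (p div n)" "Suc (p div n) < q * 2 ^ j + 2 ^ j"
      by auto
    then have "Suc (p div n) mod 2 ^ j = Suc (p div n) - q * 2 ^ j"
      by (intro mod_nat_eqI) auto
    then have "Suc (p div n) mod 2 ^ j \<noteq> 0"
      using \<open>q * 2 ^ j < Suc (p div n)\<close> by simp
    then show ?thesis
      using levin_seq_window[OF assms(3,2), of "p mod n" "p div n"] \<open>n > 0\<close> by simp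
  qed
  then have "A - L = Z - L"
    by (auto simp: A_def Z_def)
  then have "\<bar>real (card A) - real (card Z)\<bar> \<le> real (card L)"
    by (intro card_diff_le_card) (auto simp: A_def Z_def L_def I_def)
  moreover have "card L = n"
  proof -
    have "(q + 1) * 2 ^ j \<ge> 1" by (simp add: Suc_le_eq)
    then show ?thesis by (simp add: L_def diff_mult_distrib2 del: mult_Suc_right mult_Suc)
  qed
  moreover have "card Z = n * 2 ^ (j - length X)"
    unfolding Z_def I_def by (rule card_cyclic_occurrences[OF assms])
  moreover have "real (n * 2 ^ (j - length X)) = real (n * 2 ^ j) / 2 ^ length X"
    using power_diff[of "2::real", OF _ assms(3)] by simp
  ultimately show ?thesis
    unfolding occurrences_def A_def I_def by simp
qed

text \<open>The row number is rounded down to its leading \<open>i\<close> of \<open>n\<close>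
  binary digits; each further digit costs an error of at most \<open>n\<close>.\<close>

lemma occurrences_levin_dyadic:
  assumes "n = 2 ^ d" "i + length X \<le> n" "w < 2 ^ n"
  shows "\<bar>real (occurrences (levin_seq n) X 0 (n * (w div 2 ^ (n - i) * 2 ^ (n - i))))
    - real (n * (w div 2 ^ (n - i) * 2 ^ (n - i))) / 2 ^ length X\<bar> \<le> real (n * i)"
  using assms(2)
proof (induction i)
  case 0
  then show ?case using assms(3) by (simp add: occurrences_def)
next
  case (Suc i)
  define j where "j = n - Suc i"
  have j: "n - i = Suc j" "length X \<le> j" "j \<le> n" using Suc.prems by (auto simp: j_def)
  define a where "a = n * (w div 2 ^ Suc j * 2 ^ Suc j)"
  define b where "b = n * (w div 2 ^ j * 2 ^ j)"
  define D where "D x = real (occurrences (levin_seq n) X 0 x) - real x / 2 ^ length X" for x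
  have IH: "\<bar>D a\<bar> \<le> real (n * i)"
    using Suc.IH Suc.prems unfolding D_def a_def j by simp
  define q where "q = w div 2 ^ j"
  have aq: "a = n * (2 * (q div 2) * 2 ^ j)"
  proof -
    have "w div 2 ^ Suc j = q div 2"
      by (simp only: q_def power_Suc2 div_mult2_eq)
    then show ?thesis by (simp add: a_def)
  qed
  \<comment> \<open>The parity of \<open>q\<close> is the new digit: if even, \<open>b = a\<close>;
    if odd, exactly one aligned block of \<open>2 ^ j\<close> rows is added.\<close>
  have "\<bar>D b\<bar> \<le> \<bar>D a\<bar> + real n"
  proof (cases "even q")
    case True
    then show ?thesis unfolding aq b_def q_def[symmetric] by simp
  next
    case False
    then have q: "q = 2 * (q div 2) + 1" by presburger
    have b: "b = n * ((2 * (q div 2) + 1) * 2 ^ j)"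
      using q by (metis b_def q_def)
    have "a \<le> b" unfolding aq b by simp
    have ba: "real b = real a + real (n * 2 ^ j)" unfolding aq b by (simp add: algebra_simps)
    have "D b - D a = real (occurrences (levin_seq n) X a b) - real (n * 2 ^ j) / 2 ^ length X"
      using occurrences_split[of 0 a b "levin_seq n" X] \<open>a \<le> b\<close>
      unfolding D_def ba by (simp add: add_divide_distrib)
    moreover have "\<bar>\<dots>\<bar> \<le> real n"
      using occurrences_levin_block[OF assms(1) j(3,2), of "2 * (q div 2)"]
      unfolding aq b .
    ultimately show ?thesis by linarith
  qed
  then show ?case
    using IH unfolding D_def b_def j_def[symmetric] by (simp add: algebra_simps)
qed

text \<open>Whole blocks down to \<open>2 ^ k\<close> rows cost n (n - k). The rest lies in one such
  block, with at most 2 n occurrences where at most n are expected. Finally n \<ge> 1 absorbs 2 n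
  into 2 n^2.\<close>

lemma levin_seq_discrepancy:
  assumes n: "n = 2 ^ d" and X: "length X \<le> n" and M: "M < n * 2 ^ n"
  shows "\<bar>real (occurrences (levin_seq n) X 0 M) - real M / 2 ^ length X\<bar> \<le> 3 * real n ^ 2"
proof -
  define k where "k = length X"
  define w where "w = M div n"
  define q where "q = w div 2 ^ k"
  define a where "a = n * (q * 2 ^ k)"
  define c where "c = n * ((q + 1) * 2 ^ k)"
  have "n > 0" using n by simp
  have "w < 2 ^ n"
    using M by (simp add: w_def less_mult_imp_div_less mult.commute)
  then have D: "\<bar>real (occurrences (levin_seq n) X 0 a) - real a / 2 ^ k\<bar> \<le> real (n * (n - k))"
    using occurrences_levin_dyadic[OF n, of "n - k" X w] X unfolding k_def a_def q_def by simp
  have "a \<le> M"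
    unfolding a_def q_def w_def by (meson div_times_less_eq_dividend mult_le_mono2 times_div_less_eq_dividend order_trans)
  have "w < (q + 1) * 2 ^ k"
    unfolding q_def by (metis dividend_less_div_times mult.commute Suc_eq_plus1 mult_Suc_right zero_less_numeral zero_less_power)
  then have "M < c"
    unfolding w_def c_def using \<open>n > 0\<close> by (metis div_less_iff_less_mult mult.commute)
  have ca: "real c = real a + real n * 2 ^ k"
    by (simp add: a_def c_def algebra_simps)
  have "occurrences (levin_seq n) X a M \<le> occurrences (levin_seq n) X a c"
    using occurrences_split[of a M c "levin_seq n" X] \<open>a \<le> M\<close> \<open>M < c\<close> by simp
  moreover have "real (occurrences (levin_seq n) X a c) \<le> 2 * real n"
    using occurrences_levin_block[OF n X order_refl, of q]
    unfolding a_def c_def k_def by (simp add: abs_le_iff)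
  moreover have "(real M - real a) / 2 ^ k \<le> real n" "(real M - real a) / 2 ^ k \<ge> 0"
    using ca \<open>M < c\<close> \<open>a \<le> M\<close> by (simp_all add: divide_le_eq)
  moreover have "occurrences (levin_seq n) X 0 M = occurrences (levin_seq n) X 0 a + occurrences (levin_seq n) X a M"
    using \<open>a \<le> M\<close> by (intro occurrences_split) auto
  ultimately have "\<bar>real (occurrences (levin_seq n) X 0 M) - real M / 2 ^ k\<bar> \<le> real (n * (n - k)) + 2 * real n"
    using D by (simp add: diff_divide_distrib abs_le_iff)
  also have "\<dots> \<le> real n * real n + 2 * real n * real n"
    using \<open>n > 0\<close> by (intro add_mono) (auto simp flip: of_nat_mult)
  finally show ?thesis
    by (simp add: k_def power2_eq_square)
qed

section \<open>The normality measure\<close>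

lemma finite_binary_words: "finite (binary_words k)"
  unfolding binary_words_def by (rule finite_lists_length_eq) simp

lemma binary_words_nonempty: "binary_words k \<noteq> {}"
proof -
  have "replicate k 0 \<in> binary_words k"
    by (auto simp: binary_words_def)
  then show ?thesis by blast
qed

lemma le_log2_iff: "N > 0 \<Longrightarrow> real k \<le> log 2 (real N) \<longleftrightarrow> 2 ^ k \<le> N"
  using of_nat_le_iff[of "2 ^ k" N, where 'a = real]
  by (simp add: le_log_iff powr_realpow del: of_nat_le_iff)

lemma normality_measure_le:
  assumes "2 \<le> length E"
    and bound: "\<And>k X M. 1 \<le> k \<Longrightarrow> 2 ^ k \<le> length E \<Longrightarrow> X \<in> binary_words k \<Longrightarrow>
      M + k \<le> length E + 1 \<Longrightarrow> \<bar>real (block_count E M X) - real M / 2 ^ k\<bar> \<le> B"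
  shows "normality_measure E \<le> B"
proof -
  define K where "K = {k::nat. 1 \<le> k \<and> real k \<le> log 2 (real (length E))}"
  have "0 < length E" using assms(1) by linarith
  then have K: "K = {k. 1 \<le> k \<and> 2 ^ k \<le> length E}"
    unfolding K_def by (simp only: le_log2_iff)
  \<comment> \<open>This bounds the range of \<open>k\<close> and makes the range of
    \<open>M\<close> nonempty, as the maxima require.\<close>
  have less: "k < length E" if "k \<in> K" for k
    using that unfolding K by (auto intro: less_le_trans[OF less_exp])
  then have "finite K"
    by (intro finite_subset[of K "{..<length E}"]) auto
  moreover have "1 \<in> K"
    using assms(1) by (simp add: K)
  moreover have "(MAX X \<in> binary_words k. MAX M \<in> {1..length E + 1 - k}.
      \<bar>real (block_count E M X) - real M / 2 ^ k\<bar>) \<le> B" if "k \<in> K" for k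
  proof (intro Max.boundedI; (elim imageE, hypsubst)?)
    fix X assume "X \<in> binary_words k"
    show "(MAX M \<in> {1..length E + 1 - k}. \<bar>real (block_count E M X) - real M / 2 ^ k\<bar>) \<le> B"
    proof (intro Max.boundedI; (elim imageE, hypsubst)?)
      fix M assume "M \<in> {1..length E + 1 - k}"
      then show "\<bar>real (block_count E M X) - real M / 2 ^ k\<bar> \<le> B"
        using \<open>k \<in> K\<close> \<open>X \<in> binary_words k\<close> by (intro bound) (auto simp: K)
    qed (use less[OF that] in auto)
  qed (simp_all add: finite_binary_words binary_words_nonempty)
  ultimately show ?thesis
    unfolding normality_measure_def K_def[symmetric]
    by (intro Max.boundedI; (elim imageE, hypsubst)?) blast+
qed

definition levin_word :: "nat \<Rightarrow> nat \<Rightarrow> nat list" where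
  "levin_word n N = map (\<lambda>p. of_bool (levin_seq n p = 1)) [0..<N]"

lemma levin_word_in_binary_words: "levin_word n N \<in> binary_words N"
  by (auto simp: levin_word_def binary_words_def)

text \<open>The bound on \<open>M + k\<close> makes every window starting before \<open>M\<close>
  fit into the finite word, so truncation does no harm.\<close>

lemma block_count_levin_word:
  assumes "X \<in> binary_words k" "M + k \<le> N + 1"
  shows "block_count (levin_word n N) M X = occurrences (levin_seq n) (map of_nat X) 0 M"
proof -
  have len: "length X = k" using assms(1) by (simp add: binary_words_def)
  define \<phi> where "\<phi> b = (of_bool (b = (1::bit)) :: nat)" for b
  have X: "X = map \<phi> (map of_nat X)"
    unfolding map_map using assms(1)
    by (intro map_idI[symmetric]) (auto simp: binary_words_def \<phi>_def)
  have inj: "inj \<phi>"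
  proof (rule injI)
    fix x y assume "\<phi> x = \<phi> y"
    then show "x = y" by (cases x; cases y) (simp_all add: \<phi>_def)
  qed
  have "take k (drop p (levin_word n N)) = X \<longleftrightarrow> map (levin_seq n) [p..<p + k] = map of_nat X"
    if "p < M" for p
  proof -
    have "take k (drop p (levin_word n N)) = map \<phi> (map (levin_seq n) [p..<p + k])"
      using that assms(2) by (simp add: levin_word_def \<phi>_def drop_map take_map take_upt)
    then show ?thesis
      using inj_map_eq_map[OF inj, of "map (levin_seq n) [p..<p + k]" "map of_nat X"]
      by (simp only: X[symmetric])
  qed
  then show ?thesis
    unfolding block_count_def occurrences_def
    by (intro arg_cong[where f = card]) (auto simp: len)
qed

lemma normality_measure_levin_word:
  assumes "n = 2 ^ d" "2 \<le> n" "2 \<le> N" "N \<le> 2 ^ n"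
  shows "normality_measure (levin_word n N) \<le> 3 * real n ^ 2"
proof (rule normality_measure_le)
  have len: "length (levin_word n N) = N" by (simp add: levin_word_def)
  show "2 \<le> length (levin_word n N)" using assms(3) len by simp
  fix k X M
  assume "1 \<le> k" "2 ^ k \<le> length (levin_word n N)" and X: "X \<in> binary_words k"
    and M: "M + k \<le> length (levin_word n N) + 1"
  have "(2::nat) ^ k \<le> 2 ^ n"
    using \<open>2 ^ k \<le> length (levin_word n N)\<close> assms(4) unfolding len by (rule le_trans)
  then have "k \<le> n" by simp
  \<comment> \<open>The discrepancy bound needs \<open>M\<close> strictly below
    \<open>n * 2 ^ n\<close>; the assumption 2 \<le> n provides the slack.\<close>
  have "M \<le> 2 ^ n" using M \<open>1 \<le> k\<close> assms(4) len by simp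
  also have "\<dots> < 2 * 2 ^ n" by simp
  also have "\<dots> \<le> n * 2 ^ n" using assms(2) by (rule mult_le_mono1)
  finally have "M < n * 2 ^ n" .
  moreover have "length X = k" using X by (simp add: binary_words_def)
  ultimately show "\<bar>real (block_count (levin_word n N) M X) - real M / 2 ^ k\<bar> \<le> 3 * real n ^ 2"
    using levin_seq_discrepancy[OF assms(1), of "map of_nat X" M] \<open>k \<le> n\<close>
      block_count_levin_word[OF X, of M N n] M len by simp
qed

text \<open>Minimality of \<open>d\<close> gives 2^(d - 1) \<le> log_2 N, hence n \<le> 2 log_2 N
  and the constant 3 * 4 = 12. The bound 3 \<le> N excludes \<open>d = 0\<close>.\<close>

lemma ex_power_two_exponent:
  assumes "3 \<le> N"
  obtains n d where "n = 2 ^ d" "2 \<le> n" "N \<le> 2 ^ n" "3 * (real n)\<^sup>2 \<le> 12 / (ln 2)\<^sup>2 * (ln (real N))\<^sup>2"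
proof -
  define d where "d = (LEAST d. N \<le> 2 ^ (2 ^ d))"
  have "N \<le> 2 ^ (2 ^ N)"
    using less_exp[of N] less_exp[of "2 ^ N"] by linarith
  then have d: "N \<le> 2 ^ (2 ^ d)"
    unfolding d_def by (rule LeastI)
  then have "d \<noteq> 0"
    using assms by (intro notI) simp
  then obtain d' where d': "d = Suc d'"
    using not0_implies_Suc by blast
  have "2 ^ (2 ^ d') < N"
    using not_less_Least[of d' "\<lambda>d. N \<le> 2 ^ (2 ^ d)"] d' unfolding d_def by simp
  then have "real (2 ^ d') \<le> log 2 (real N)"
    using assms le_log2_iff[of N "2 ^ d'"] by linarith
  moreover have "real (2 ^ d) = 2 * real (2 ^ d')"
    by (simp add: d')
  ultimately have "(real (2 ^ d))\<^sup>2 \<le> (2 * log 2 (real N))\<^sup>2"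
    by (intro power_mono) simp_all
  also have "\<dots> = 4 / (ln 2)\<^sup>2 * (ln (real N))\<^sup>2"
    by (simp add: log_def power_divide power_mult_distrib)
  finally have "3 * (real (2 ^ d))\<^sup>2 \<le> 12 / (ln 2)\<^sup>2 * (ln (real N))\<^sup>2"
    by simp
  moreover have "(2::nat) \<le> 2 ^ d"
    by (simp add: d')
  ultimately show ?thesis
    using that[OF refl _ d] by blast
qed

lemma min_normality_measure_le:
  assumes "n = 2 ^ d" "2 \<le> n" "2 \<le> N" "N \<le> 2 ^ n"
  shows "(MIN E \<in> binary_words N. normality_measure E) \<le> 3 * (real n)\<^sup>2"
  by (rule order_trans[OF Min_le normality_measure_levin_word[OF assms]])
    (intro finite_imageI imageI levin_word_in_binary_words finite_binary_words)+

theorem theorem1: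
  shows "\<exists>c::real. \<forall>\<^sub>F N in sequentially.
    (MIN E \<in> binary_words N. normality_measure E) \<le> c * (ln (real N))\<^sup>2"
proof (intro exI eventually_sequentiallyI)
  fix N :: nat assume "3 \<le> N"
  then obtain n d where n: "n = 2 ^ d" "2 \<le> n" "N \<le> 2 ^ n"
    "3 * (real n)\<^sup>2 \<le> 12 / (ln 2)\<^sup>2 * (ln (real N))\<^sup>2"
    by (rule ex_power_two_exponent)
  have "2 \<le> N"
    using \<open>3 \<le> N\<close> by (rule order_trans[rotated]) simp
  then show "(MIN E \<in> binary_words N. normality_measure E) \<le> 12 / (ln 2)\<^sup>2 * (ln (real N))\<^sup>2"
    by (rule order_trans[OF min_normality_measure_le[OF n(1,2) _ n(3)] n(4)])
qed

end
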